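(* Let $f(x)\in\mathbb{Z}[x]$ be monic and irreducible, of degree $n$. Let $c\in\mathbb{Z}$ and define $F(x)=x^n f\left(x+\frac1x+c\right)$. Let $\alpha$ be a root of $f(x)$ and $\beta$ be a root of $F(x)$. If $F$ is irreducible and $\mathbb{Z}[\alpha]\neq\mathcal{O}_{\mathbb{Q}(\alpha)}$, then $\mathbb{Z}[\beta]\neq\mathcal{O}_{\mathbb{Q}(\beta)}$.
   Context: $\mathcal{O}_K$ denotes the ring of integers of a number field $K$. Irreducible means irreducible over $\mathbb{Q}$. $F$ is a monic polynomial in $\mathbb{Z}[x]$ of degree $2n$. *)

theory Defs
  imports "HOL-Computational_Algebra.Computational_Algebra"
begin

definition is_subfield :: "'a :: field set \<Rightarrow> bool" where
  "is_subfield K \<longleftrightarrow> 0 \<in> K \<and> 1 \<in> K \<and>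
     (\<forall>x\<in>K. \<forall>y\<in>K. x + y \<in> K \<and> x - y \<in> K \<and> x * y \<in> K) \<and> (\<forall>x\<in>K. inverse x \<in> K)"

text \<open>In characteristic 0 every subfield contains the rationals, so the smallest subfield
  containing \<open>a\<close> is \<open>\<rat>(a)\<close>.\<close>

definition rat_adjoin :: "'a :: field_char_0 \<Rightarrow> 'a set" where
  "rat_adjoin a = is_subfield hull {a}"

definition int_adjoin :: "'a :: field_char_0 \<Rightarrow> 'a set" where
  "int_adjoin a = {poly (map_poly of_int p) a | p :: int poly. True}"

definition ring_of_integers :: "'a :: field_char_0 set \<Rightarrow> 'a set" where
  "ring_of_integers K = {x \<in> K. algebraic_int x}"

text \<open>The rational function \<open>x\<^sup>n f(x + 1/x + c)\<close>, where \<open>n = deg f\<close>, as an element of the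
  fraction field of \<open>\<int>[x]\<close>.\<close>

definition recip_subst :: "int poly \<Rightarrow> int \<Rightarrow> int poly fract" where
  "recip_subst f c =
     (let X = to_fract [:0, 1:]
      in X ^ degree f * poly (map_poly of_int f) (X + 1 / X + of_int c))"

text \<open>This rational function is a polynomial over the integers, and it is monic of degree \<open>2n\<close>
  if \<open>f\<close> is monic of degree \<open>n\<close>.\<close>

lemma of_int_fract_poly: "(of_int k :: int poly fract) = to_fract [:k:]"
proof -
  have nat: "(of_nat m :: int poly fract) = to_fract (of_nat m)" for m
    by (induction m) auto
  have "(of_int k :: int poly fract) = to_fract (of_int k)"
    by (cases k rule: int_cases2) (simp_all add: nat)
  thus ?thesis by (simp add: of_int_poly)
qed

lemma to_fract_power: "to_fract (p ^ k) = to_fract p ^ k"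
  by (induction k) auto

lemma recip_subst_is_polynomial:
  assumes "lead_coeff f = 1"
  shows "\<exists>!F. to_fract F = recip_subst f c"
    and "to_fract F = recip_subst f c \<Longrightarrow> degree F = 2 * degree f \<and> lead_coeff F = 1"
proof -
  define n where "n = degree f"
  define X :: "int poly fract" where "X = to_fract [:0, 1:]"
  define t :: "nat \<Rightarrow> int poly"
    where "t = (\<lambda>i. smult (coeff f i) ([:0, 1:] ^ (n - i) * [:1, c, 1:] ^ i))"
  define G where "G = (\<Sum>i\<le>n. t i)"
  have X: "X \<noteq> 0" by (simp add: X_def)
  have q: "to_fract [:1, c, 1:] = X * (X + 1 / X + of_int c)"
  proof -
    have "[:1, c, 1:] = [:0, 1:] * [:0, 1:] + 1 + [:0, 1:] * [:c:]"
      by (simp add: one_pCons)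
    hence "to_fract [:1, c, 1:] = X * X + 1 + X * of_int c"
      by (simp only: to_fract_add to_fract_mult to_fract_1 X_def of_int_fract_poly)
    thus ?thesis using X by (simp add: field_simps)
  qed
  have summand: "to_fract (t i) = X ^ n * (of_int (coeff f i) * (X + 1 / X + of_int c) ^ i)"
    if "i \<le> n" for i
  proof -
    have "t i = [:coeff f i:] * ([:0, 1:] ^ (n - i) * [:1, c, 1:] ^ i)"
      by (simp add: t_def)
    hence "to_fract (t i) = of_int (coeff f i) * (X ^ (n - i) * (X * (X + 1 / X + of_int c)) ^ i)"
      by (simp only: to_fract_mult to_fract_power q of_int_fract_poly X_def)
    also have "\<dots> = (X ^ (n - i) * X ^ i) * (of_int (coeff f i) * (X + 1 / X + of_int c) ^ i)"
      by (simp only: power_mult_distrib mult_ac)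
    also have "X ^ (n - i) * X ^ i = X ^ n"
      using that by (simp flip: power_add)
    finally show ?thesis .
  qed
  have "degree (map_poly of_int f :: int poly fract poly) = n"
    unfolding n_def using assms by (intro map_poly_degree_eq) auto
  hence "recip_subst f c = X ^ n * (\<Sum>i\<le>n. of_int (coeff f i) * (X + 1 / X + of_int c) ^ i)"
    by (simp add: recip_subst_def Let_def poly_altdef coeff_map_poly n_def X_def)
  also have "\<dots> = to_fract G"
    by (simp add: G_def sum_distrib_left summand)
  finally have G: "to_fract G = recip_subst f c" ..
  show "\<exists>!F. to_fract F = recip_subst f c"
    using G by (metis to_fract_eq_iff)
  have deg_le: "degree (t i) \<le> n + i" if "i \<le> n" for i
  proof -
    have "degree (t i) \<le> degree ([:0, 1:] ^ (n - i) * [:1, c, 1:] ^ i)"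
      unfolding t_def by (rule degree_smult_le)
    also have "\<dots> \<le> n + i"
      using that by (simp add: degree_mult_eq degree_power_eq)
    finally show ?thesis .
  qed
  have "t n = [:1, c, 1:] ^ n"
    using assms by (simp add: t_def n_def)
  hence deg_n: "degree (t n) = 2 * n" and lead_n: "lead_coeff (t n) = 1"
    using lead_coeff_power[of "[:1, c, 1:]" n] by (simp_all add: degree_power_eq)
  have coeff_G: "coeff G (2 * n) = 1"
  proof -
    have "coeff G (2 * n) = (\<Sum>i\<le>n. coeff (t i) (2 * n))"
      by (simp add: G_def coeff_sum)
    also have "\<dots> = (\<Sum>i\<in>{n}. coeff (t i) (2 * n))"
      using deg_le by (intro sum.mono_neutral_right) (auto intro!: coeff_eq_0 le_less_trans[OF deg_le])
    finally show ?thesis using deg_n lead_n by auto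
  qed
  have "degree G \<le> 2 * n"
    unfolding G_def using deg_le by (intro degree_sum_le) (auto intro: order_trans[OF deg_le])
  hence "degree G = 2 * n"
    using coeff_G by (intro antisym le_degree) auto
  thus "degree F = 2 * degree f \<and> lead_coeff F = 1" if "to_fract F = recip_subst f c"
    using that G coeff_G by (metis n_def to_fract_eq_iff)
qed

end

theory Submission
  imports Defs "HOL-Computational_Algebra.Field_as_Ring"
begin

text \<open>
  Put \<open>\<gamma> = \<beta> + 1/\<beta> + c\<close>. Then \<open>f(\<gamma>) = 0\<close>, and since \<open>f\<close> is irreducible, \<open>\<alpha>\<close> and \<open>\<gamma>\<close> satisfy
  the same polynomial relations over \<open>\<rat>\<close> (\<open>conjugate_root\<close>). So for a rational polynomial \<open>g\<close>
  the properties ``\<open>g(\<alpha>)\<close> is an algebraic integer'' and ``\<open>g(\<alpha>) \<in> \<int>[\<alpha>]\<close>'' may be tested at \<open>\<gamma>\<close>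
  instead of \<open>\<alpha>\<close>.

  The core of the proof is that an element of \<open>\<rat>(\<gamma>)\<close> which lies in \<open>\<int>[\<beta>]\<close> already lies in
  \<open>\<int>[\<gamma>]\<close> (\<open>int_adjoin_descent\<close>). From \<open>\<beta>\<^sup>2 = (\<gamma> - c) \<beta> - 1\<close> it follows that every element of \<open>\<int>[\<beta>]\<close> has
  the form \<open>a(\<gamma>) + b(\<gamma>) \<beta>\<close> with integer polynomials \<open>a\<close> and \<open>b\<close>. The polynomial \<open>F\<close> is palindromic,
  so \<open>1/\<beta>\<close> is a conjugate of \<open>\<beta>\<close>, and the conjugation \<open>\<beta> \<mapsto> 1/\<beta>\<close> fixes \<open>\<gamma>\<close>. An element of
  \<open>\<rat>(\<gamma>)\<close> is fixed by it, hence \<open>b(\<gamma>) (\<beta> - 1/\<beta>) = 0\<close>. As \<open>F\<close> is irreducible of degree at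
  least 2, \<open>\<beta>\<close> is not \<open>\<plusminus>1\<close>, so \<open>b(\<gamma>) = 0\<close> and the element is \<open>a(\<gamma>)\<close>.

  Now suppose that \<open>\<int>[\<beta>]\<close> is the ring of integers of \<open>\<rat>(\<beta>)\<close>, and let \<open>g(\<alpha>)\<close> be an element of
  \<open>\<rat>(\<alpha>)\<close>. If \<open>g(\<alpha>)\<close> is an algebraic integer, then so is \<open>g(\<gamma>)\<close>; it therefore lies in
  \<open>\<int>[\<beta>]\<close>, hence in \<open>\<int>[\<gamma>]\<close>, and \<open>g(\<alpha>) \<in> \<int>[\<alpha>]\<close>. Conversely \<open>\<gamma> \<in> \<int>[\<beta>]\<close>, because \<open>F(0) = 1\<close>
  makes \<open>\<beta>\<close> a unit of \<open>\<int>[\<beta>]\<close>; so all elements of \<open>\<int>[\<gamma>]\<close>, and with them those of \<open>\<int>[\<alpha>]\<close>,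
  are algebraic integers. Thus \<open>\<int>[\<alpha>]\<close> is the ring of integers of \<open>\<rat>(\<alpha>)\<close>.
\<close>

section \<open>Evaluating integer and rational polynomials in a larger field\<close>

abbreviation int_eval :: "int poly \<Rightarrow> 'a :: comm_ring_1 \<Rightarrow> 'a" where
  "int_eval p x \<equiv> poly (map_poly of_int p) x"

abbreviation rat_eval :: "rat poly \<Rightarrow> 'a :: field_char_0 \<Rightarrow> 'a" where
  "rat_eval p x \<equiv> poly (map_poly of_rat p) x"

lemma map_poly_add_hom:
  assumes "h 0 = 0" "\<And>a b. h (a + b) = h a + h b"
  shows "map_poly h (p + q) = map_poly h p + map_poly h q"
  by (rule poly_eqI) (simp add: coeff_map_poly assms)

lemma map_poly_mult_hom:
  fixes h :: "'a :: comm_ring_1 \<Rightarrow> 'b :: comm_ring_1"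
  assumes "h 0 = 0" "\<And>a b. h (a + b) = h a + h b" "\<And>a b. h (a * b) = h a * h b"
  shows "map_poly h (p * q) = map_poly h p * map_poly h q"
proof (induction p)
  case (pCons a p)
  have "map_poly h (smult a q) = smult (h a) (map_poly h q)"
    by (rule poly_eqI) (simp add: coeff_map_poly assms)
  with pCons.IH show ?case
    by (simp add: map_poly_add_hom map_poly_pCons assms)
qed simp

lemma poly_map_poly_pcompose_hom:
  fixes h :: "'a :: comm_ring_1 \<Rightarrow> 'b :: comm_ring_1"
  assumes "h 0 = 0" "\<And>a b. h (a + b) = h a + h b" "\<And>a b. h (a * b) = h a * h b"
  shows "poly (map_poly h (p \<circ>\<^sub>p q)) x = poly (map_poly h p) (poly (map_poly h q) x)"
  by (induction p)
     (simp_all add: pcompose_pCons map_poly_add_hom map_poly_mult_hom map_poly_pCons assms)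

lemma int_eval_pCons [simp]: "int_eval (pCons a p) x = of_int a + x * int_eval p x"
  by (simp add: map_poly_pCons)

lemma int_eval_add [simp]: "int_eval (p + q) x = int_eval p x + int_eval q x"
  by (simp add: map_poly_add_hom)

lemma int_eval_mult [simp]: "int_eval (p * q) x = int_eval p x * int_eval q x"
  by (simp add: map_poly_mult_hom)

lemma int_eval_pcompose: "int_eval (p \<circ>\<^sub>p q) x = int_eval p (int_eval q x)"
  by (rule poly_map_poly_pcompose_hom) simp_all

lemma int_eval_uminus [simp]: "int_eval (- p) x = - int_eval p x"
  using int_eval_add[of "- p" p x] by (simp add: eq_neg_iff_add_eq_0)

lemma int_eval_diff [simp]: "int_eval (p - q) x = int_eval p x - int_eval q x"
  using int_eval_add[of p "- q" x] by simp

lemma int_eval_power [simp]: "int_eval (p ^ k) x = int_eval p x ^ k"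
  by (induction k) simp_all

lemma int_eval_smult [simp]: "int_eval (smult a p) x = of_int a * int_eval p x"
  using int_eval_mult[of "[:a:]" p x] by simp

lemma int_eval_sum: "int_eval (sum t A) x = (\<Sum>i\<in>A. int_eval (t i) x)"
  by (induction A rule: infinite_finite_induct) simp_all

lemma rat_eval_pCons [simp]: "rat_eval (pCons a p) x = of_rat a + x * rat_eval p x"
  by (simp add: map_poly_pCons)

lemma rat_eval_add [simp]: "rat_eval (p + q) x = rat_eval p x + rat_eval q x"
  by (simp add: map_poly_add_hom of_rat_add)

lemma rat_eval_mult [simp]: "rat_eval (p * q) x = rat_eval p x * rat_eval q x"
  by (simp add: map_poly_mult_hom of_rat_add of_rat_mult)

lemma rat_eval_pcompose: "rat_eval (p \<circ>\<^sub>p q) x = rat_eval p (rat_eval q x)"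
  by (rule poly_map_poly_pcompose_hom) (simp_all add: of_rat_add of_rat_mult)

lemma rat_eval_uminus [simp]: "rat_eval (- p) x = - rat_eval p x"
  using rat_eval_add[of "- p" p x] by (simp add: eq_neg_iff_add_eq_0)

lemma rat_eval_diff [simp]: "rat_eval (p - q) x = rat_eval p x - rat_eval q x"
  using rat_eval_add[of p "- q" x] by simp

lemma rat_eval_of_int_poly: "rat_eval (map_poly of_int p) x = int_eval p x"
  by (simp add: map_poly_map_poly o_def)

section \<open>Roots of an irreducible rational polynomial\<close>

lemma irreducible_bezout:
  fixes P h :: "rat poly"
  assumes "irreducible P" and "\<not> P dvd h"
  obtains u v where "u * P + v * h = 1"
proof -
  have "coprime P h"
    using assms by (intro prime_elem_imp_coprime irreducible_imp_prime_elem)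
  hence "gcd P h = 1" by simp
  thus thesis
    using that bezout_coefficients_fst_snd[of P h] by metis
qed

lemma irreducible_dvd_of_root:
  assumes "irreducible P" and "rat_eval P x = 0" and "rat_eval h x = 0"
  shows "P dvd h"
proof (rule ccontr)
  assume "\<not> P dvd h"
  then obtain u v where "u * P + v * h = 1"
    using irreducible_bezout assms(1) by blast
  hence "rat_eval (u * P + v * h) x = rat_eval 1 x" by simp
  thus False using assms by simp
qed

text \<open>The two roots may lie in different fields. This replaces the isomorphism
  \<open>\<rat>(x) \<cong> \<rat>(y)\<close> that maps \<open>x\<close> to \<open>y\<close>.\<close>

lemma conjugate_root:
  assumes "irreducible P" and "rat_eval P x = 0" and "rat_eval P y = 0"
    and "rat_eval h x = 0"
  shows "rat_eval h y = 0"
  using irreducible_dvd_of_root[OF assms(1,2,4)] assms(3) by (auto elim!: dvdE)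

lemma conjugate_root_int:
  fixes x :: "'a :: field_char_0" and y :: "'b :: field_char_0"
  assumes "irreducible (map_poly rat_of_int f)"
    and "int_eval f x = 0" and "int_eval f y = 0" and "int_eval h x = 0"
  shows "int_eval h y = 0"
  using conjugate_root[of "map_poly of_int f" x y "map_poly of_int h"] assms
  by (simp add: rat_eval_of_int_poly)

lemma conjugate_algebraic_int:
  assumes "irreducible P" and "rat_eval P x = 0" and "rat_eval P y = 0"
    and "algebraic_int (rat_eval g x)"
  shows "algebraic_int (rat_eval g y)"
proof -
  obtain p where p: "int_eval p (rat_eval g x) = 0" "lead_coeff p = 1"
    using assms(4) by (auto simp: algebraic_int_altdef_ipoly)
  have "rat_eval (map_poly of_int p \<circ>\<^sub>p g) x = 0"
    using p by (simp only: rat_eval_pcompose rat_eval_of_int_poly)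
  hence "rat_eval (map_poly of_int p \<circ>\<^sub>p g) y = 0"
    by (rule conjugate_root[OF assms(1-3)])
  thus ?thesis
    using p by (auto simp: algebraic_int_altdef_ipoly rat_eval_pcompose rat_eval_of_int_poly)
qed

lemma conjugate_int_adjoin:
  assumes "irreducible P" and "rat_eval P x = 0" and "rat_eval P y = 0"
    and "rat_eval g x \<in> int_adjoin x"
  shows "rat_eval g y \<in> int_adjoin y"
proof -
  obtain p where "rat_eval g x = int_eval p x"
    using assms(4) by (auto simp: int_adjoin_def)
  hence "rat_eval (g - map_poly of_int p) x = 0"
    by (simp add: rat_eval_of_int_poly)
  hence "rat_eval (g - map_poly of_int p) y = 0"
    by (rule conjugate_root[OF assms(1-3)])
  hence "rat_eval g y = int_eval p y"
    by (simp add: rat_eval_of_int_poly)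
  thus ?thesis by (auto simp: int_adjoin_def)
qed

section \<open>The field generated by a root\<close>

lemma is_subfield_rat_adjoin: "is_subfield (rat_adjoin x)"
  unfolding rat_adjoin_def by (rule hull_in) (auto simp: is_subfield_def)

lemma rat_adjoin_generator: "x \<in> rat_adjoin x"
  unfolding rat_adjoin_def by (rule hull_inc) simp

lemma of_rat_in_subfield:
  assumes "is_subfield K"
  shows "of_rat r \<in> K"
proof -
  have nat: "of_nat n \<in> K" for n
    by (induction n) (use assms in \<open>auto simp: is_subfield_def\<close>)
  have int: "of_int k \<in> K" for k
  proof (cases k rule: int_cases2)
    case (nonpos n)
    have "0 - of_nat n \<in> K"
      using assms nat unfolding is_subfield_def by blast
    thus ?thesis using nonpos by simp
  qed (simp add: nat)
  obtain a b where "r = Rat.Fract a b" "b > 0" by (cases r) auto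
  hence "of_rat r = of_int a * (inverse (of_int b) :: 'a)"
    by (simp add: of_rat_rat divide_inverse)
  thus ?thesis
    using assms int unfolding is_subfield_def by simp
qed

lemma rat_eval_in_subfield:
  assumes "is_subfield K" and "x \<in> K"
  shows "rat_eval g x \<in> K"
proof (induction g)
  case 0
  show ?case using assms by (simp add: is_subfield_def)
next
  case (pCons a g)
  thus ?case
    using assms of_rat_in_subfield[OF assms(1), of a] by (simp add: is_subfield_def)
qed

lemma rat_adjoin_eq_range:
  assumes "irreducible P" and "rat_eval P x = 0"
  shows "rat_adjoin x = range (\<lambda>g. rat_eval g x)"
proof
  let ?K = "range (\<lambda>g. rat_eval g x)"
  have "inverse (rat_eval g x) \<in> ?K" for g
  proof (cases "P dvd g")
    case True
    hence "inverse (rat_eval g x) = rat_eval 0 x"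
      using assms(2) by (auto elim!: dvdE)
    thus ?thesis by blast
  next
    case False
    then obtain u v where "u * P + v * g = 1"
      using irreducible_bezout assms(1) by blast
    hence "rat_eval (u * P + v * g) x = rat_eval 1 x" by simp
    hence "rat_eval v x * rat_eval g x = 1"
      using assms(2) by simp
    hence "inverse (rat_eval g x) = rat_eval v x"
      by (metis inverse_unique mult.commute)
    thus ?thesis by blast
  qed
  moreover have "0 \<in> ?K" "1 \<in> ?K"
    by (rule image_eqI[of _ _ 0]; simp) (rule image_eqI[of _ _ 1]; simp)
  moreover have "rat_eval g x + rat_eval h x \<in> ?K" "rat_eval g x - rat_eval h x \<in> ?K"
      "rat_eval g x * rat_eval h x \<in> ?K" for g h
    by (simp_all flip: rat_eval_add rat_eval_diff rat_eval_mult)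
  ultimately have "is_subfield ?K"
    by (auto simp: is_subfield_def)
  moreover have "x \<in> ?K"
    by (rule image_eqI[of _ _ "[:0, 1:]"]) simp_all
  ultimately show "rat_adjoin x \<subseteq> ?K"
    unfolding rat_adjoin_def by (intro hull_minimal) simp_all
  show "?K \<subseteq> rat_adjoin x"
    by (auto intro: rat_eval_in_subfield is_subfield_rat_adjoin rat_adjoin_generator)
qed

section \<open>The polynomial \<open>x\<^sup>n f(x + 1/x + c)\<close>\<close>

definition recip_poly :: "int poly \<Rightarrow> int \<Rightarrow> int poly" where
  "recip_poly f c =
     (\<Sum>i\<le>degree f. smult (coeff f i) ([:0, 1:] ^ (degree f - i) * [:1, c, 1:] ^ i))"

text \<open>The field is arbitrary because the lemma is used twice: at the generator of the fraction
  field of \<open>\<int>[x]\<close>, where it identifies \<open>recip_poly f c\<close>, and at \<open>\<beta>\<close>.\<close>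

lemma int_eval_recip_poly:
  fixes t :: "'k :: field"
  assumes "lead_coeff f = 1" and "t \<noteq> 0"
  shows "int_eval (recip_poly f c) t = t ^ degree f * int_eval f (t + 1 / t + of_int c)"
proof -
  define n where "n = degree f"
  define y where "y = t + 1 / t + of_int c"
  have q: "int_eval [:1, c, 1:] t = t * y"
    using assms(2) by (simp add: y_def field_simps)
  have "int_eval (smult (coeff f i) ([:0, 1:] ^ (n - i) * [:1, c, 1:] ^ i)) t
      = t ^ n * (of_int (coeff f i) * y ^ i)" if "i \<le> n" for i
  proof -
    have "int_eval (smult (coeff f i) ([:0, 1:] ^ (n - i) * [:1, c, 1:] ^ i)) t
        = of_int (coeff f i) * (t ^ (n - i) * (t * y) ^ i)"
      by (simp only: int_eval_smult int_eval_mult int_eval_power q) simp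
    also have "\<dots> = (t ^ (n - i) * t ^ i) * (of_int (coeff f i) * y ^ i)"
      by (simp only: power_mult_distrib mult_ac)
    also have "t ^ (n - i) * t ^ i = t ^ n"
      using that by (simp flip: power_add)
    finally show ?thesis .
  qed
  hence "int_eval (recip_poly f c) t = t ^ n * (\<Sum>i\<le>n. of_int (coeff f i) * y ^ i)"
    unfolding recip_poly_def int_eval_sum sum_distrib_left n_def[symmetric]
    by (intro sum.cong) auto
  moreover have "degree (map_poly of_int f :: 'k poly) = n"
    unfolding n_def using assms by (intro map_poly_degree_eq) auto
  ultimately show ?thesis
    by (simp add: poly_altdef coeff_map_poly y_def flip: n_def)
qed

lemma int_eval_to_fract: "int_eval p (to_fract [:0, 1:]) = to_fract p"
proof (induction p)
  case (pCons a p)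
  have "pCons a p = [:a:] + [:0, 1:] * p" by simp
  hence "to_fract (pCons a p) = of_int a + to_fract [:0, 1:] * to_fract p"
    by (simp only: to_fract_add to_fract_mult of_int_fract_poly)
  thus ?case using pCons.IH by simp
qed simp

lemma recip_subst_eq_recip_poly:
  assumes "lead_coeff f = 1"
  shows "recip_subst f c = to_fract (recip_poly f c)"
proof -
  have "to_fract [:0, 1 :: int:] \<noteq> 0" by simp
  from int_eval_recip_poly[OF assms this, of c] show ?thesis
    by (simp only: int_eval_to_fract recip_subst_def Let_def)
qed

lemma coeff_0_recip_poly:
  assumes "lead_coeff f = 1"
  shows "coeff (recip_poly f c) 0 = 1"
proof -
  have "coeff (recip_poly f c) 0 = (\<Sum>i\<le>degree f. coeff f i * 0 ^ (degree f - i))"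
    by (simp add: recip_poly_def poly_sum poly_power flip: poly_0_coeff_0)
  also have "\<dots> = (\<Sum>i\<in>{degree f}. coeff f i * 0 ^ (degree f - i))"
    by (intro sum.mono_neutral_right) auto
  finally show ?thesis using assms by simp
qed

text \<open>If \<open>p = 1 + X r\<close>, then \<open>p(x) = 0\<close> says \<open>x \<cdot> (- r(x)) = 1\<close>.\<close>

lemma inverse_in_int_adjoin:
  fixes x :: "'a :: field_char_0"
  assumes "int_eval p x = 0" and "coeff p 0 = 1"
  obtains J where "int_eval J x = 1 / x"
proof -
  obtain r where "p = pCons 1 r"
    using assms(2) by (cases p) auto
  hence r: "1 + x * int_eval r x = 0"
    using assms(1) by simp
  hence "x \<noteq> 0" by auto
  hence "int_eval (- r) x = 1 / x"
    using r by (simp add: field_simps add_eq_0_iff2)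
  thus thesis using that by blast
qed

section \<open>Descent from \<open>\<int>[\<beta>]\<close> to \<open>\<int>[\<beta> + 1/\<beta> + c]\<close>\<close>

text \<open>With \<open>y = t + 1/t + c\<close> this is division by \<open>x\<^sup>2 - (y - c) x + 1\<close>, whose two roots are \<open>t\<close> and \<open>1/t\<close>. What matters is
  that \<open>a\<close> and \<open>b\<close> do not depend on \<open>t\<close>, so that the same pair serves \<open>t\<close> and \<open>1/t\<close>.\<close>

lemma int_eval_decompose:
  "\<exists>a b. \<forall>t :: 'a :: field_char_0. t \<noteq> 0 \<longrightarrow>
     int_eval p t = int_eval a (t + 1 / t + of_int c) + int_eval b (t + 1 / t + of_int c) * t"
proof (induction p)
  case 0
  show ?case by (intro exI[of _ 0]) simp
next
  case (pCons k p)
  then obtain a b where IH: "int_eval p t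
      = int_eval a (t + 1 / t + of_int c) + int_eval b (t + 1 / t + of_int c) * t"
    if "t \<noteq> 0" for t :: 'a by blast
  show ?case
  proof (rule exI[of _ "[:k:] - b"], rule exI[of _ "a + b * [:-c, 1:]"], intro allI impI)
    fix t :: 'a assume t: "t \<noteq> 0"
    define y where "y = t + 1 / t + of_int c"
    have sq: "t * t = (y - of_int c) * t - 1"
      using t by (simp add: y_def field_simps)
    have "int_eval (pCons k p) t = of_int k + int_eval a y * t + int_eval b y * (t * t)"
      using IH[OF t] by (simp add: y_def algebra_simps)
    also have "\<dots> = int_eval ([:k:] - b) y + int_eval (a + b * [:-c, 1:]) y * t"
      unfolding sq by (simp add: algebra_simps)
    finally show "int_eval (pCons k p) t = int_eval ([:k:] - b) (t + 1 / t + of_int c)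
        + int_eval (a + b * [:-c, 1:]) (t + 1 / t + of_int c) * t"
      by (simp add: y_def)
  qed
qed

text \<open>An element of \<open>\<rat>(\<gamma>) \<inter> \<int>[\<beta>]\<close> has the form \<open>a(\<gamma>) + b(\<gamma>) \<beta>\<close> and is fixed by the conjugation
  \<open>\<beta> \<mapsto> 1/\<beta>\<close>, which turns it into \<open>a(\<gamma>) + b(\<gamma>)/\<beta>\<close>. Comparing the two expressions gives \<open>b(\<gamma>) = 0\<close>.
  To stay with polynomials, \<open>1/\<beta>\<close> and \<open>\<gamma>\<close> are written as integer polynomials \<open>J\<close> and \<open>S\<close> in \<open>\<beta>\<close>;
  then conjugation is the transfer of polynomial relations from the root \<open>\<beta>\<close> to the root \<open>1/\<beta>\<close>.\<close>

lemma int_adjoin_descent: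
  fixes \<beta> :: "'a :: field_char_0" and c :: int
  defines "\<gamma> \<equiv> \<beta> + 1 / \<beta> + of_int c"
  assumes irr: "irreducible (map_poly rat_of_int F)" and deg: "degree F \<ge> 2"
    and coeff0: "coeff F 0 = 1"
    and root: "int_eval F \<beta> = 0" and root': "int_eval F (1 / \<beta>) = 0"
    and mem: "rat_eval g \<gamma> \<in> int_adjoin \<beta>"
  shows "rat_eval g \<gamma> \<in> int_adjoin \<gamma>"
proof -
  obtain J where J: "int_eval J \<beta> = 1 / \<beta>"
    using inverse_in_int_adjoin root coeff0 by blast
  have \<beta>0: "\<beta> \<noteq> 0"
    using root coeff0 by (cases F) auto
  define S where "S = [:c, 1:] + J"
  have S: "int_eval S \<beta> = \<gamma>"
    using J by (simp add: S_def \<gamma>_def)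
  obtain p where p: "rat_eval g \<gamma> = int_eval p \<beta>"
    using mem by (auto simp: int_adjoin_def)

  \<comment> \<open>Conjugating the relation \<open>\<beta> J(\<beta>) = 1\<close> shows that \<open>\<beta> \<mapsto> 1/\<beta>\<close> fixes \<open>\<gamma> = S(\<beta>)\<close>.\<close>
  have "int_eval ([:0, 1:] * J - 1) \<beta> = 0"
    using J \<beta>0 by simp
  hence "int_eval ([:0, 1:] * J - 1) (1 / \<beta>) = 0"
    by (rule conjugate_root_int[OF irr root root'])
  hence "int_eval J (1 / \<beta>) = \<beta>"
    using \<beta>0 by simp
  hence S': "int_eval S (1 / \<beta>) = \<gamma>"
    by (simp add: S_def \<gamma>_def)

  have "rat_eval (map_poly of_int p - g \<circ>\<^sub>p map_poly of_int S) \<beta> = 0"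
    using p S by (simp add: rat_eval_of_int_poly rat_eval_pcompose)
  hence "rat_eval (map_poly of_int p - g \<circ>\<^sub>p map_poly of_int S) (1 / \<beta>) = 0"
    by (rule conjugate_root[OF irr, rotated 2]) (simp_all only: rat_eval_of_int_poly root root')
  hence p': "int_eval p (1 / \<beta>) = int_eval p \<beta>"
    using p S' by (simp add: rat_eval_of_int_poly rat_eval_pcompose)

  obtain a b where ab: "int_eval p t
      = int_eval a (t + 1 / t + of_int c) + int_eval b (t + 1 / t + of_int c) * t"
    if "t \<noteq> 0" for t :: 'a using int_eval_decompose[of p c] by blast
  have "int_eval p \<beta> = int_eval a \<gamma> + int_eval b \<gamma> * \<beta>"
    using ab[of \<beta>] \<beta>0 by (simp add: \<gamma>_def)
  moreover have "int_eval p (1 / \<beta>) = int_eval a \<gamma> + int_eval b \<gamma> * (1 / \<beta>)"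
    using ab[of "1 / \<beta>"] \<beta>0 by (simp add: \<gamma>_def add.commute)
  moreover have "\<beta> \<noteq> 1 / \<beta>"
  proof
    \<comment> \<open>Otherwise \<open>\<beta> = \<plusminus>1\<close> would be a root of a linear polynomial, which \<open>F\<close> would divide.\<close>
    assume "\<beta> = 1 / \<beta>"
    hence "(\<beta> - 1) * (\<beta> + 1) = 0"
      using \<beta>0 by (simp add: field_simps)
    then obtain e :: rat where "rat_eval [:e, 1:] \<beta> = 0"
    proof -
      assume "(\<beta> - 1) * (\<beta> + 1) = 0"
      hence "rat_eval [:-1, 1:] \<beta> = 0 \<or> rat_eval [:1, 1:] \<beta> = 0"
        by (auto simp: of_rat_minus add.commute)
      thus thesis using that by blast
    qed
    hence "map_poly of_int F dvd [:e, 1:]"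
      using root by (intro irreducible_dvd_of_root[OF irr]) (simp_all add: rat_eval_of_int_poly)
    hence "degree (map_poly rat_of_int F) \<le> 1"
      using dvd_imp_degree_le[of "map_poly of_int F" "[:e, 1:]"] by simp
    thus False using deg by (simp add: degree_map_poly)
  qed
  ultimately have "int_eval b \<gamma> * (\<beta> - 1 / \<beta>) = 0" and "\<beta> - 1 / \<beta> \<noteq> 0"
    using p' by (simp_all add: right_diff_distrib)
  hence "int_eval b \<gamma> = 0"
    by (simp only: mult_eq_0_iff simp_thms)
  hence "rat_eval g \<gamma> = int_eval a \<gamma>"
    using p \<open>int_eval p \<beta> = int_eval a \<gamma> + int_eval b \<gamma> * \<beta>\<close> by simp
  thus ?thesis by (auto simp: int_adjoin_def)
qed

section \<open>The ring of integers\<close>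

theorem theorem1p4:
  fixes f F :: "int poly" and c :: int
    and \<alpha> :: "'a :: field_char_0" and \<beta> :: "'b :: field_char_0"
  assumes "lead_coeff f = 1"
    and "irreducible (map_poly rat_of_int f)"
    and "to_fract F = recip_subst f c"
    and "poly (map_poly of_int f) \<alpha> = 0"
    and "poly (map_poly of_int F) \<beta> = 0"
    and "irreducible (map_poly rat_of_int F)"
    and "int_adjoin \<alpha> \<noteq> ring_of_integers (rat_adjoin \<alpha>)"
  shows "int_adjoin \<beta> \<noteq> ring_of_integers (rat_adjoin \<beta>)"
proof
  assume max: "int_adjoin \<beta> = ring_of_integers (rat_adjoin \<beta>)"
  define \<gamma> where "\<gamma> = \<beta> + 1 / \<beta> + of_int c"
  let ?f = "map_poly rat_of_int f"

  have F: "F = recip_poly f c"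
    using assms(3) recip_subst_eq_recip_poly[OF assms(1)] by simp
  have coeff0: "coeff F 0 = 1"
    by (simp add: F coeff_0_recip_poly[OF assms(1)])
  have \<beta>0: "\<beta> \<noteq> 0"
    using assms(5) coeff0 by (cases F) auto
  have "\<beta> ^ degree f * int_eval f \<gamma> = 0"
    using assms(5) int_eval_recip_poly[OF assms(1) \<beta>0, of c] by (simp add: F \<gamma>_def)
  hence f\<gamma>: "int_eval f \<gamma> = 0"
    using \<beta>0 by simp
  have F': "int_eval F (1 / \<beta>) = 0"
    using int_eval_recip_poly[OF assms(1), of "1 / \<beta>" c] \<beta>0 f\<gamma>
    by (simp add: F \<gamma>_def add.commute)
  have "degree ?f \<noteq> 0"
    using assms(2) by (auto simp: irreducible_def is_unit_iff_degree)
  hence "degree f > 0"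
    by (simp add: degree_map_poly)
  hence deg: "degree F \<ge> 2"
    using recip_subst_is_polynomial(2)[OF assms(1,3)] by simp

  have \<alpha>: "rat_eval ?f \<alpha> = 0" and \<gamma>: "rat_eval ?f \<gamma> = 0"
    using assms(4) f\<gamma> by (simp_all only: rat_eval_of_int_poly)
  have "\<gamma> \<in> rat_adjoin \<beta>"
  proof -
    have "1 / \<beta> \<in> rat_adjoin \<beta>"
      using is_subfield_rat_adjoin[of \<beta>] rat_adjoin_generator[of \<beta>]
      by (simp add: is_subfield_def divide_inverse)
    moreover have "of_int c \<in> rat_adjoin \<beta>"
      using of_rat_in_subfield[OF is_subfield_rat_adjoin, of "of_int c"] by simp
    ultimately show ?thesis
      using is_subfield_rat_adjoin[of \<beta>] rat_adjoin_generator[of \<beta>]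
      unfolding \<gamma>_def is_subfield_def by blast
  qed
  hence mem: "rat_eval g \<gamma> \<in> rat_adjoin \<beta>" for g
    by (intro rat_eval_in_subfield is_subfield_rat_adjoin)

  have sub: "x \<in> int_adjoin \<alpha>" if x: "x \<in> ring_of_integers (rat_adjoin \<alpha>)" for x
  proof -
    obtain g where g: "x = rat_eval g \<alpha>"
      using x rat_adjoin_eq_range[OF assms(2) \<alpha>] by (auto simp: ring_of_integers_def)
    have "algebraic_int (rat_eval g \<gamma>)"
      using x g by (intro conjugate_algebraic_int[OF assms(2) \<alpha> \<gamma>]) (simp add: ring_of_integers_def)
    hence "rat_eval g \<gamma> \<in> int_adjoin \<beta>"
      using mem max by (simp add: ring_of_integers_def)
    hence "rat_eval g \<gamma> \<in> int_adjoin \<gamma>"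
      unfolding \<gamma>_def using int_adjoin_descent[OF assms(6) deg coeff0 assms(5) F'] by blast
    thus ?thesis
      unfolding g by (rule conjugate_int_adjoin[OF assms(2) \<gamma> \<alpha>])
  qed

  have sup: "x \<in> ring_of_integers (rat_adjoin \<alpha>)" if x: "x \<in> int_adjoin \<alpha>" for x
  proof -
    obtain p where p: "x = int_eval p \<alpha>"
      using x by (auto simp: int_adjoin_def)
    obtain J where J: "int_eval J \<beta> = 1 / \<beta>"
      using inverse_in_int_adjoin assms(5) coeff0 by blast
    have "int_eval (p \<circ>\<^sub>p ([:c, 1:] + J)) \<beta> = int_eval p \<gamma>"
      using J by (simp add: int_eval_pcompose \<gamma>_def add_ac)
    hence "int_eval p \<gamma> \<in> int_adjoin \<beta>"
      unfolding int_adjoin_def by (metis (mono_tags, lifting) mem_Collect_eq)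
    hence "algebraic_int (rat_eval (map_poly of_int p) \<gamma>)"
      using max by (simp add: ring_of_integers_def rat_eval_of_int_poly)
    hence "algebraic_int (rat_eval (map_poly of_int p) \<alpha>)"
      by (rule conjugate_algebraic_int[OF assms(2) \<gamma> \<alpha>])
    moreover have "rat_eval (map_poly of_int p) \<alpha> \<in> rat_adjoin \<alpha>"
      by (intro rat_eval_in_subfield is_subfield_rat_adjoin rat_adjoin_generator)
    ultimately show ?thesis
      by (simp add: p ring_of_integers_def rat_eval_of_int_poly)
  qed

  show False
    using sub sup assms(7) by blast
qed

end
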